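(* Let $d\geq 1$, let $Q=\{x\in\mathbb{R}^d:x_i\geq 0\ \text{for all } 1\leq i\leq d\}$ be the first orthant, and let $\mathfrak{S}\subset\mathbb{Z}^d$ be a finite set of steps such that: (i) $\mathfrak{S}$ is not included in a linear hyperplane of $\mathbb{R}^d$; (ii) $\mathfrak{S}$ is not included in a half-space $u^-=\{y\in\mathbb{R}^d:\langle u,y\rangle\leq 0\}$ with $u\in Q\setminus\{0\}$; (iii) $\mathfrak{S}$ allows a path staying in $Q$ from the origin to some point in the interior of $Q$, i.e. there are $k\geq 1$ and $s_1,\dots,s_k\in\mathfrak{S}$ with $s_1+\cdots+s_j\in Q$ for all $1\leq j\leq k$ and $s_1+\cdots+s_k$ in the interior of $Q$. Fix a starting point $x\in Q$. Let $K_{\mathfrak{S}}$ be the growth constant for the total number of $\mathfrak{S}$-walks starting at $x$ and confined to $Q$. Let $\mathcal{P}$ be the set of hyperplanes through the origin in $\mathbb{R}^d$ which do not meet the interior of $Q$. Given $p\in\mathcal{P}$, let $K_{\mathfrak{S}}(p)$ be the growth constant of the $\mathfrak{S}$-walks starting at $x$ which are restricted to the side of $p$ which includes $Q$. Then $$K_{\mathfrak{S}}=\min_{p\in\mathcal{P}}K_{\mathfrak{S}}(p).$$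
   Context: $\langle\cdot,\cdot\rangle$ is the standard inner product on $\mathbb{R}^d$. For a set $A\subset\mathbb{R}^d$ containing $x$, the number of $\mathfrak{S}$-walks of length $n$ starting at $x$ and confined (restricted) to $A$ is the number $f_A(n)$ of sequences $(s_1,\dots,s_n)\in\mathfrak{S}^n$ such that $x+s_1+\cdots+s_k\in A$ for all $1\leq k\leq n$ (the endpoint is arbitrary); the associated growth constant is $\limsup_{n\to\infty}f_A(n)^{1/n}$. The side of $p$ which includes the first orthant is the closed half-space bounded by $p$ that contains $Q$: every $p\in\mathcal{P}$ is of the form $p=\{y:\langle u,y\rangle=0\}$ with $u\in Q$, $|u|=1$, and this side is $\{y\in\mathbb{R}^d:\langle y,u\rangle\geq 0\}$. *)

theory Defs
  imports "HOL-Analysis.Analysis"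
begin

definition orthant :: "(real^'n) set" where
  "orthant = {x. \<forall>i. 0 \<le> x $ i}"

definition linear_hyperplane :: "(real^'n) set \<Rightarrow> bool" where
  "linear_hyperplane p \<longleftrightarrow> (\<exists>u. u \<noteq> 0 \<and> p = {y. u \<bullet> y = 0})"

definition walks :: "(real^'n) set \<Rightarrow> (real^'n) set \<Rightarrow> real^'n \<Rightarrow> nat \<Rightarrow> (real^'n) list set" where
  "walks S A x n = {s. length s = n \<and> set s \<subseteq> S \<and> (\<forall>k\<in>{1..n}. x + sum_list (take k s) \<in> A)}"

text \<open>The limsup is taken in \<^typ>\<open>ereal\<close>, as it needs a complete lattice; for finite \<open>S\<close> the
  sequence is bounded by \<open>card S\<close>, so the value is a real number.\<close>

definition growth_constant :: "(real^'n) set \<Rightarrow> (real^'n) set \<Rightarrow> real^'n \<Rightarrow> ereal" where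
  "growth_constant S A x = limsup (\<lambda>n. ereal (root n (real (card (walks S A x n)))))"

definition supporting_hyperplanes :: "(real^'n) set set" where
  "supporting_hyperplanes = {p. linear_hyperplane p \<and> p \<inter> interior orthant = {}}"

text \<open>Well defined on \<open>supporting_hyperplanes\<close>; see \<open>supporting_hyperplanes_eq\<close> and
  \<open>orthant_side_eq\<close> below.\<close>

definition orthant_side :: "(real^'n) set \<Rightarrow> (real^'n) set" where
  "orthant_side p = (THE H. orthant \<subseteq> H \<and>
     (\<exists>u. u \<noteq> 0 \<and> p = {y. u \<bullet> y = 0} \<and> H = {y. 0 \<le> u \<bullet> y}))"

lemma interior_orthant: "interior orthant = {y::real^'n. \<forall>i. 0 < y $ i}"
proof (intro equalityI subsetI)
  fix y :: "real^'n" assume "y \<in> interior orthant"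
  then obtain e where e: "e > 0" "ball y e \<subseteq> orthant" by (auto simp: mem_interior)
  have "0 < y $ i" for i
  proof -
    have "y - axis i (e/2) \<in> ball y e"
      using e by (simp add: dist_norm norm_eq_sqrt_inner inner_axis_axis real_sqrt_divide)
    then have "0 \<le> (y - axis i (e/2)) $ i" using e unfolding orthant_def by blast
    then show ?thesis using e by (simp add: axis_def)
  qed
  then show "y \<in> {y. \<forall>i. 0 < y $ i}" by simp
next
  fix y :: "real^'n" assume y: "y \<in> {y. \<forall>i. 0 < y $ i}"
  have "{y::real^'n. \<forall>i. 0 < y $ i} = (\<Inter>i. {y. 0 < y $ i})" by auto
  also have "open \<dots>"
    by (intro open_INT) (auto intro!: open_Collect_less continuous_intros)
  finally have "open {y::real^'n. \<forall>i. 0 < y $ i}" .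
  then show "y \<in> interior orthant"
    using y by (intro interiorI[of "{y::real^'n. \<forall>i. 0 < y $ i}"])
      (auto simp: orthant_def less_imp_le)
qed

lemma inner_orthant_pos:
  fixes u y :: "real^'n"
  assumes "u \<in> orthant" "u \<noteq> 0" "\<And>i. 0 < y $ i"
  shows "0 < u \<bullet> y"
proof -
  obtain j where j: "u $ j \<noteq> 0" using assms(2) by (auto simp: vec_eq_iff)
  then have "0 < u $ j" using assms(1) by (auto simp: orthant_def less_le)
  then show ?thesis
    unfolding inner_vec_def inner_real_def
    by (intro sum_pos2[where i=j])
      (use assms in \<open>auto simp: orthant_def less_imp_le intro!: mult_nonneg_nonneg\<close>)
qed

lemma orthant_if_pos:
  fixes u :: "real^'n"
  assumes "\<And>y. (\<And>i. 0 < y $ i) \<Longrightarrow> 0 \<le> u \<bullet> y"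
  shows "u \<in> orthant"
proof -
  define w :: "real^'n" where "w = (\<chi> i. 1)"
  have "0 \<le> u $ i" for i
  proof (rule tendsto_lowerbound)
    show "((\<lambda>e. u \<bullet> (axis i 1 + e *\<^sub>R w)) \<longlongrightarrow> u $ i) (at_right 0)"
      by (auto intro!: tendsto_eq_intros simp: inner_axis)
    show "\<forall>\<^sub>F e in at_right 0. 0 \<le> u \<bullet> (axis i 1 + e *\<^sub>R w)"
    proof (rule eventually_mono[OF eventually_at_right_less[of 0]])
      fix e :: real assume "0 < e"
      then show "0 \<le> u \<bullet> (axis i 1 + e *\<^sub>R w)"
        by (intro assms) (auto simp: w_def axis_def)
    qed
  qed auto
  then show ?thesis by (simp add: orthant_def)
qed

lemma supporting_hyperplanes_eq:
  "supporting_hyperplanes = {p::(real^'n) set. \<exists>u\<in>orthant. norm u = 1 \<and> p = {y. u \<bullet> y = 0}}"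
    (is "_ = ?R")
proof (intro equalityI subsetI)
  fix p :: "(real^'n) set" assume "p \<in> ?R"
  then obtain u where u: "u \<in> orthant" "norm u = 1" "p = {y. u \<bullet> y = 0}" by blast
  then have "u \<noteq> 0" by auto
  with u inner_orthant_pos[of u] show "p \<in> supporting_hyperplanes"
    by (fastforce simp: supporting_hyperplanes_def linear_hyperplane_def interior_orthant)
next
  fix p :: "(real^'n) set" assume "p \<in> supporting_hyperplanes"
  then obtain u where u: "u \<noteq> 0" "p = {y. u \<bullet> y = 0}" "p \<inter> interior orthant = {}"
    by (auto simp: supporting_hyperplanes_def linear_hyperplane_def)
  have conv: "convex (orthant :: (real^'n) set)"
    by (auto simp: convex_def orthant_def)
  have nz: "u \<bullet> y \<noteq> 0" if "y \<in> interior orthant" for y using u that by auto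
  have "u \<in> orthant \<or> - u \<in> orthant"
  proof (rule ccontr)
    assume "\<not> ?thesis"
    then have "u \<notin> orthant" "- u \<notin> orthant" by auto
    then obtain y z where yz: "\<And>i. 0 < y $ i" "u \<bullet> y < 0" "\<And>i. 0 < z $ i" "(- u) \<bullet> z < 0"
      using orthant_if_pos[of u] orthant_if_pos[of "- u"] unfolding not_le[symmetric] by blast
    have c: "connected (interior (orthant :: (real^'n) set))"
      using conv by (intro convex_connected convex_interior)
    have yi: "y \<in> interior orthant" and zi: "z \<in> interior orthant"
      using yz(1,3) by (simp_all add: interior_orthant)
    have "\<exists>w\<in>interior orthant. u \<bullet> w = 0"
      by (rule connected_ivt_hyperplane[OF c yi zi]) (use yz in simp_all)
    then show False using nz by blast
  qed
  moreover have "p = {y. (- u) \<bullet> y = 0}" using u(2) by simp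
  moreover have "- u \<noteq> 0" using u(1) by simp
  ultimately obtain v where v: "v \<in> orthant" "v \<noteq> 0" "p = {y. v \<bullet> y = 0}"
    using u(1,2) by blast
  show "p \<in> ?R"
  proof (intro CollectI bexI[of _ "v /\<^sub>R norm v"] conjI)
    show "v /\<^sub>R norm v \<in> orthant" "norm (v /\<^sub>R norm v) = 1" "p = {y. (v /\<^sub>R norm v) \<bullet> y = 0}"
      using v by (auto simp: orthant_def)
  qed
qed

lemma orthant_side_eq:
  fixes u :: "real^'n"
  assumes u: "u \<in> orthant" "u \<noteq> 0"
  shows "orthant_side {y. u \<bullet> y = 0} = {y. 0 \<le> u \<bullet> y}"
  unfolding orthant_side_def
proof (rule the_equality)
  have "orthant \<subseteq> {y. 0 \<le> u \<bullet> y}"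
    using u by (auto simp: orthant_def inner_vec_def intro!: sum_nonneg)
  then show "orthant \<subseteq> {y. 0 \<le> u \<bullet> y} \<and> (\<exists>w. w \<noteq> 0 \<and>
      {y. u \<bullet> y = 0} = {y. w \<bullet> y = 0} \<and> {y. 0 \<le> u \<bullet> y} = {y. 0 \<le> w \<bullet> y})"
    using u by blast
next
  fix H assume "orthant \<subseteq> H \<and> (\<exists>w. w \<noteq> 0 \<and> {y. u \<bullet> y = 0} = {y. w \<bullet> y = 0} \<and> H = {y. 0 \<le> w \<bullet> y})"
  then obtain w where w: "w \<noteq> 0" "{y. u \<bullet> y = 0} = {y. w \<bullet> y = 0}" "H = {y. 0 \<le> w \<bullet> y}"
    and H: "orthant \<subseteq> H" by blast
  define c where "c = (w \<bullet> u) / (u \<bullet> u)"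
  define z where "z = w - c *\<^sub>R u"
  have "u \<bullet> z = 0" using u by (simp add: z_def c_def inner_diff_right inner_commute)
  moreover from this have "w \<bullet> z = 0" using w(2) by blast
  ultimately have "z \<bullet> z = 0" by (simp add: z_def inner_diff_left)
  then have wc: "w = c *\<^sub>R u" by (simp add: z_def)
  have "0 \<le> w \<bullet> u" using H u w by blast
  then have "0 \<le> c" using u by (simp add: c_def)
  with w(1) wc have "0 < c" by (cases "c = 0") auto
  with wc w(3) show "H = {y. 0 \<le> u \<bullet> y}" by (auto simp: zero_le_mult_iff)
qed

end

theory Submission
  imports Defs "HOL-Real_Asymp.Real_Asymp"
begin

text \<open>
  Both sides are computed by the Laplace transform \<open>L y = (\<Sum>s\<in>S. exp (s \<bullet> y))\<close>: the common value is
  the minimum of \<open>L\<close> over the orthant. The supporting hyperplanes are those with a normal vector in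
  the orthant, and the half-space of each contains the orthant, so the inequality for every \<open>p\<close> is
  monotonicity of the growth constant. It remains to find one half-space that is no better than the
  orthant.

  Some path \<open>v\<close> in the orthant leads from the origin to an interior point, all of whose coordinates
  are positive integers, hence at least \<open>1\<close>. Thus for every \<open>y\<close> in the orthant some step has an inner
  product with \<open>y\<close> of at least \<open>\<bar>y\<bar> / length v\<close>, so \<open>L\<close> tends to infinity there and attains a minimum
  at some \<open>y\<close> (\<open>laplace_attains_min_on_orthant\<close>). The half-space sought is \<open>{z. 0 \<le> y \<bullet> z}\<close>, as its
  growth constant is at most \<open>L y\<close> and that of the orthant is at least \<open>L y\<close>.

  Upper bound (\<open>growth_constant_halfspace_le\<close>), a Chernoff estimate: a walk from \<open>x\<close> that ends in the
  half-space \<open>{z. 0 \<le> y \<bullet> z}\<close> has \<open>exp (y \<bullet> (x + s\<^sub>1 + \<dots> + s\<^sub>n)) \<ge> 1\<close>, and these weights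
  sum to \<open>exp (x \<bullet> y) * L y ^ n\<close> over all words of length \<open>n\<close>.

  Lower bound (\<open>growth_constant_orthant_ge_laplace_min\<close>): first, it suffices to find many words of one
  length whose sum lies in the orthant, wherever they go in between. Walking along \<open>v\<close>
  sufficiently often leads so far into the orthant that such words can then be concatenated freely
  without leaving it (\<open>growth_constant_orthant_ge_block_root\<close>). Second, such words are counted under
  the tilted law \<open>p s = exp (s \<bullet> y) / L y\<close>. Its mean \<open>m\<close> is a positive multiple of the gradient of
  \<open>L\<close> at the minimiser, so the first-order conditions say that \<open>m\<close> lies in the orthant and that
  \<open>m \<bullet> y \<le> 0\<close>. By Chebyshev's inequality a word of \<open>n = M\<^sup>2\<close> random steps has its sum within
  \<open>c * M\<close> of \<open>n m\<close> with probability at least one half. Each such word has probability at most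
  \<open>exp (\<bar>y\<bar> c M) / L y ^ n\<close>, so there are at least \<open>L y ^ n * exp (- \<bar>y\<bar> c M) / 2\<close> of them, and
  since \<open>m\<close> lies in the orthant, appending \<open>v\<close> to each of them \<open>c * M\<close> times brings their sums
  into the orthant. The correction costs a length of order \<open>M\<close>, negligible beside \<open>M\<^sup>2\<close>.
\<close>

section \<open>Weighted sums over words\<close>

definition words :: "'a set \<Rightarrow> nat \<Rightarrow> 'a list set" where
  "words S n = {w. set w \<subseteq> S \<and> length w = n}"

lemma finite_words: "finite S \<Longrightarrow> finite (words S n)"
  unfolding words_def by (rule finite_lists_length_eq)

lemma words_0: "words S 0 = {[]}"
  by (auto simp: words_def)

lemma sum_words_Suc:
  "(\<Sum>w\<in>words S (Suc n). f w) = (\<Sum>s\<in>S. \<Sum>w\<in>words S n. f (s # w))"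
proof -
  have "words S (Suc n) = (\<lambda>(s, w). s # w) ` (S \<times> words S n)"
    by (auto simp: words_def length_Suc_conv)
  moreover have "inj_on (\<lambda>(s, w). s # w) (S \<times> words S n)"
    by (auto simp: inj_on_def)
  ultimately show ?thesis
    by (simp add: sum.reindex sum.cartesian_product case_prod_unfold)
qed

lemma sum_words_prod_list:
  fixes p :: "'a \<Rightarrow> real"
  shows "(\<Sum>w\<in>words S n. prod_list (map p w)) = (\<Sum>s\<in>S. p s) ^ n"
  by (induction n)
    (simp_all add: words_0 sum_words_Suc sum_distrib_left[symmetric] sum_distrib_right[symmetric])

text \<open>
  When \<open>p\<close> is a probability on the letters, this and the next lemma give the first two moments of a
  sum of independent centred vectors.
\<close>

lemma sum_words_first_moment:
  fixes p :: "'a \<Rightarrow> real" and g :: "'a \<Rightarrow> 'b::real_inner"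
  assumes "(\<Sum>s\<in>S. p s) = 1" and "(\<Sum>s\<in>S. p s *\<^sub>R g s) = 0"
  shows "(\<Sum>w\<in>words S n. prod_list (map p w) *\<^sub>R sum_list (map g w)) = 0"
proof (induction n)
  case (Suc n)
  have split: "(p s * prod_list (map p w)) *\<^sub>R (g s + sum_list (map g w))
      = prod_list (map p w) *\<^sub>R p s *\<^sub>R g s + p s *\<^sub>R prod_list (map p w) *\<^sub>R sum_list (map g w)"
    for s w
    by (simp add: scaleR_right_distrib mult.commute)
  have "(\<Sum>w\<in>words S (Suc n). prod_list (map p w) *\<^sub>R sum_list (map g w))
      = (\<Sum>s\<in>S. \<Sum>w\<in>words S n. (p s * prod_list (map p w)) *\<^sub>R (g s + sum_list (map g w)))"
    by (simp add: sum_words_Suc)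
  also have "\<dots> = (\<Sum>s\<in>S. (\<Sum>w\<in>words S n. prod_list (map p w)) *\<^sub>R p s *\<^sub>R g s
          + p s *\<^sub>R (\<Sum>w\<in>words S n. prod_list (map p w) *\<^sub>R sum_list (map g w)))"
    unfolding split sum.distrib scaleR_sum_left scaleR_sum_right ..
  finally show ?case
    using assms by (simp add: Suc sum_words_prod_list)
qed (simp add: words_0)

lemma sum_words_second_moment:
  fixes p :: "'a \<Rightarrow> real" and g :: "'a \<Rightarrow> 'b::real_inner"
  assumes p1: "(\<Sum>s\<in>S. p s) = 1" and g0: "(\<Sum>s\<in>S. p s *\<^sub>R g s) = 0"
  shows "(\<Sum>w\<in>words S n. prod_list (map p w) * (norm (sum_list (map g w)))\<^sup>2)
       = n * (\<Sum>s\<in>S. p s * (norm (g s))\<^sup>2)"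
proof (induction n)
  case (Suc n)
  define P where "P w = prod_list (map p w)" for w
  define G where "G w = sum_list (map g w)" for w
  have P1: "(\<Sum>w\<in>words S n. P w) = 1"
    using p1 by (simp add: P_def sum_words_prod_list)
  have PG: "(\<Sum>w\<in>words S n. P w *\<^sub>R G w) = 0"
    using sum_words_first_moment[OF p1 g0] by (simp add: P_def G_def)
  \<comment> \<open>The cross term vanishes after summation because the first moment does.\<close>
  have expand: "p s * P w * (norm (g s + G w))\<^sup>2
      = p s * (norm (g s))\<^sup>2 * P w + 2 * p s * (g s \<bullet> (P w *\<^sub>R G w)) + p s * (P w * (norm (G w))\<^sup>2)"
    for s w
    by (simp add: power2_norm_eq_inner inner_add_left inner_add_right inner_commute algebra_simps)
  have "(\<Sum>w\<in>words S n. p s * P w * (norm (g s + G w))\<^sup>2)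
      = p s * (norm (g s))\<^sup>2 * (\<Sum>w\<in>words S n. P w)
      + 2 * p s * (g s \<bullet> (\<Sum>w\<in>words S n. P w *\<^sub>R G w))
      + p s * (\<Sum>w\<in>words S n. P w * (norm (G w))\<^sup>2)" for s
    unfolding expand sum.distrib inner_sum_right sum_distrib_left ..
  also have "\<dots> s = p s * (norm (g s))\<^sup>2 + p s * (n * (\<Sum>s\<in>S. p s * (norm (g s))\<^sup>2))" for s
    using Suc P1 PG by (simp add: P_def G_def)
  finally have "(\<Sum>s\<in>S. \<Sum>w\<in>words S n. p s * P w * (norm (g s + G w))\<^sup>2)
      = (\<Sum>s\<in>S. p s * (norm (g s))\<^sup>2) + (\<Sum>s\<in>S. p s) * (n * (\<Sum>s\<in>S. p s * (norm (g s))\<^sup>2))"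
    by (simp add: sum.distrib sum_distrib_right)
  then show ?case
    by (simp add: sum_words_Suc P_def G_def p1 algebra_simps)
qed (simp add: words_0)

lemma words_Chebyshev:
  fixes p :: "'a \<Rightarrow> real" and g :: "'a \<Rightarrow> 'b::real_inner"
  assumes fin: "finite S" and nonneg: "\<And>s. s \<in> S \<Longrightarrow> 0 \<le> p s"
    and p1: "(\<Sum>s\<in>S. p s) = 1" and g0: "(\<Sum>s\<in>S. p s *\<^sub>R g s) = 0" and T: "0 < T"
  shows "1 - n * (\<Sum>s\<in>S. p s * (norm (g s))\<^sup>2) / T\<^sup>2
       \<le> (\<Sum>w\<in>{w\<in>words S n. norm (sum_list (map g w)) \<le> T}. prod_list (map p w))"
proof -
  define P where "P w = prod_list (map p w)" for w
  define G where "G w = sum_list (map g w)" for w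
  let ?W = "words S n"
  have Pnn: "0 \<le> P w" if "w \<in> ?W" for w
  proof -
    have "set w \<subseteq> S" using that by (simp add: words_def)
    then show ?thesis unfolding P_def using nonneg by (induction w) auto
  qed
  have "1 = (\<Sum>w\<in>?W. P w)"
    using p1 by (simp add: P_def sum_words_prod_list)
  also have "\<dots> \<le> (\<Sum>w\<in>?W. (if norm (G w) \<le> T then P w else 0) + P w * (norm (G w))\<^sup>2 / T\<^sup>2)"
  proof (rule sum_mono)
    fix w assume w: "w \<in> ?W"
    have "P w \<le> P w * (norm (G w))\<^sup>2 / T\<^sup>2" if "T < norm (G w)"
    proof -
      have "T\<^sup>2 \<le> (norm (G w))\<^sup>2"
        using that T by (intro power_mono) auto
      then show ?thesis
        using T Pnn[OF w] by (simp add: pos_le_divide_eq mult_left_mono)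
    qed
    then show "P w \<le> (if norm (G w) \<le> T then P w else 0) + P w * (norm (G w))\<^sup>2 / T\<^sup>2"
      using Pnn[OF w] by auto
  qed
  also have "\<dots> = (\<Sum>w\<in>{w\<in>?W. norm (G w) \<le> T}. P w)
      + (\<Sum>w\<in>?W. P w * (norm (G w))\<^sup>2) / T\<^sup>2"
    by (simp add: sum.distrib sum_divide_distrib sum.inter_filter finite_words fin)
  finally show ?thesis
    using sum_words_second_moment[OF p1 g0, of n] by (simp add: P_def G_def)
qed

section \<open>The Laplace transform of the step set\<close>

definition laplace :: "(real^'n) set \<Rightarrow> real^'n \<Rightarrow> real" where
  "laplace S y = (\<Sum>s\<in>S. exp (s \<bullet> y))"

lemma laplace_pos: "finite S \<Longrightarrow> S \<noteq> {} \<Longrightarrow> 0 < laplace S y"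
  unfolding laplace_def by (rule sum_pos) auto

lemma prod_list_exp_inner:
  "prod_list (map (\<lambda>s. exp (s \<bullet> y)) w) = exp (sum_list w \<bullet> y)"
  for y :: "'a::real_inner"
  by (induction w) (simp_all add: inner_add_left exp_add)

lemma sum_list_inner_le:
  fixes y :: "'a::real_inner" and b :: real
  assumes "\<And>s. s \<in> set w \<Longrightarrow> s \<bullet> y \<le> b"
  shows "sum_list w \<bullet> y \<le> length w * b"
  using assms by (induction w) (auto simp: inner_add_left algebra_simps intro!: add_mono)

text \<open>
  On the orthant \<open>\<bar>y\<bar> \<le> sum_list v \<bullet> y\<close>, since all coordinates of \<open>sum_list v\<close> are at least one. As
  \<open>sum_list v \<bullet> y\<close> is a sum of \<open>length v\<close> terms \<open>s \<bullet> y \<le> ln (laplace S y)\<close>, a bound on the transform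
  bounds \<open>y\<close>, and minimising over the orthant reduces to minimising over a compact set.
\<close>

lemma laplace_attains_min_on_orthant:
  fixes S :: "(real^'n) set"
  assumes fin: "finite S" and v: "set v \<subseteq> S" and v1: "\<And>i. 1 \<le> sum_list v $ i"
  obtains y where "y \<in> orthant" "\<And>z. z \<in> orthant \<Longrightarrow> laplace S y \<le> laplace S z"
proof -
  define R where "R = real (length v) * ln (laplace S 0)"
  have "v \<noteq> []"
    using v1 by (metis not_one_le_zero sum_list.Nil zero_index)
  then have ne: "S \<noteq> {}"
    using v by (cases v) auto
  have bound: "norm y \<le> R" if y: "y \<in> orthant" and le: "laplace S y \<le> laplace S 0" for y
  proof -
    have "s \<bullet> y \<le> ln (laplace S 0)" if "s \<in> S" for s
    proof -
      have "exp (s \<bullet> y) \<le> laplace S y"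
        unfolding laplace_def using fin that by (intro member_le_sum) auto
      then show ?thesis
        using le laplace_pos[OF fin ne] by (simp add: ln_ge_iff)
    qed
    then have "sum_list v \<bullet> y \<le> R"
      unfolding R_def by (rule sum_list_inner_le) (use v in blast)
    moreover have "norm y \<le> (\<Sum>i\<in>UNIV. \<bar>y $ i\<bar>)"
      by (rule norm_le_l1_cart)
    moreover have "(\<Sum>i\<in>UNIV. \<bar>y $ i\<bar>) \<le> sum_list v \<bullet> y"
      unfolding inner_vec_def inner_real_def
    proof (rule sum_mono)
      fix i
      have "0 \<le> y $ i" using y by (simp add: orthant_def)
      then show "\<bar>y $ i\<bar> \<le> sum_list v $ i * y $ i"
        using v1[of i] mult_right_mono[of 1 "sum_list v $ i" "y $ i"] by simp
    qed
    ultimately show ?thesis by linarith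
  qed
  have R0: "0 \<le> R"
    using bound[of 0] by (simp add: orthant_def)
  have "closed (orthant :: (real^'n) set)"
    unfolding orthant_def by (intro closed_Collect_all closed_Collect_le continuous_intros)
  then have "compact (orthant \<inter> cball 0 R :: (real^'n) set)"
    by (rule closed_Int_compact) simp
  moreover have zero: "0 \<in> (orthant \<inter> cball 0 R :: (real^'n) set)"
    using R0 by (simp add: orthant_def)
  moreover have "continuous_on (orthant \<inter> cball 0 R) (laplace S)"
    unfolding laplace_def by (intro continuous_intros)
  ultimately obtain y where y: "y \<in> orthant \<inter> cball 0 R"
    and min: "\<And>z. z \<in> orthant \<inter> cball 0 R \<Longrightarrow> laplace S y \<le> laplace S z"
    using continuous_attains_inf[of "orthant \<inter> cball 0 R" "laplace S"] by blast
  show thesis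
  proof
    show "y \<in> orthant" using y by simp
  next
    fix z assume "z \<in> (orthant :: (real^'n) set)"
    then show "laplace S y \<le> laplace S z"
      using min[of z] min[OF zero] bound[of z] by (cases "laplace S z \<le> laplace S 0") auto
  qed
qed

text \<open>
  The first-order condition for a minimum over the orthant, along a direction \<open>d\<close> that initially
  stays inside it. The vector on the left of the inner product is the gradient.
\<close>

lemma laplace_min_gradient_nonneg:
  fixes S :: "(real^'n) set"
  assumes min: "\<And>z. z \<in> orthant \<Longrightarrow> laplace S y \<le> laplace S z"
    and d: "\<And>t. 0 < t \<Longrightarrow> t \<le> 1 \<Longrightarrow> y + t *\<^sub>R d \<in> orthant"
  shows "0 \<le> (\<Sum>s\<in>S. exp (s \<bullet> y) *\<^sub>R s) \<bullet> d"
proof (rule ccontr)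
  define D where "D = (\<Sum>s\<in>S. exp (s \<bullet> y) *\<^sub>R s) \<bullet> d"
  assume "\<not> 0 \<le> (\<Sum>s\<in>S. exp (s \<bullet> y) *\<^sub>R s) \<bullet> d"
  then have "D < 0" by (simp add: D_def)
  have "((\<lambda>t. \<Sum>s\<in>S. exp (s \<bullet> y + t * (s \<bullet> d))) has_real_derivative D) (at 0)"
    unfolding D_def inner_sum_left
    by (auto intro!: derivative_eq_intros sum.cong simp: mult.commute)
  from DERIV_neg_dec_right[OF this \<open>D < 0\<close>] obtain e where "e > 0"
    and e: "\<And>t. 0 < t \<Longrightarrow> t < e \<Longrightarrow> laplace S (y + t *\<^sub>R d) < laplace S y"
    by (auto simp: laplace_def inner_add_right)
  define t where "t = min (e / 2) 1"
  have "0 < t" "t < e" "t \<le> 1" using \<open>e > 0\<close> by (auto simp: t_def)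
  then show False
    using e[of t] min[OF d[of t]] by simp
qed

section \<open>Growth constants of half-spaces\<close>

lemma walks_subset_words: "walks S A x n \<subseteq> words S n"
  by (auto simp: walks_def words_def)

lemma finite_walks: "finite S \<Longrightarrow> finite (walks S A x n)"
  using finite_subset[OF walks_subset_words finite_words] .

lemma growth_constant_mono:
  assumes "finite S" "A \<subseteq> B"
  shows "growth_constant S A x \<le> growth_constant S B x"
  unfolding growth_constant_def
proof (rule Limsup_mono, rule eventually_mono[OF eventually_gt_at_top[of 0]])
  fix n :: nat assume "0 < n"
  have "walks S A x n \<subseteq> walks S B x n"
    using assms(2) by (auto simp: walks_def)
  then have "card (walks S A x n) \<le> card (walks S B x n)"
    using assms(1) by (intro card_mono finite_walks)
  then show "ereal (root n (real (card (walks S A x n))))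
      \<le> ereal (root n (real (card (walks S B x n))))"
    using \<open>0 < n\<close> by simp
qed

text \<open>
  Only the endpoint matters: a word that ends in the half-space has weight at least one in a sum that
  factorises over the letters.
\<close>

lemma card_walks_halfspace_le:
  fixes S :: "(real^'n) set"
  assumes fin: "finite S" and n: "0 < n"
  shows "real (card (walks S {z. 0 \<le> y \<bullet> z} x n)) \<le> exp (x \<bullet> y) * laplace S y ^ n"
proof -
  let ?W = "walks S {z. 0 \<le> y \<bullet> z} x n"
  have "1 \<le> exp (x \<bullet> y) * exp (sum_list w \<bullet> y)" if "w \<in> ?W" for w
  proof -
    have "length w = n" "\<forall>k\<in>{1..n}. 0 \<le> y \<bullet> (x + sum_list (take k w))"
      using that by (auto simp: walks_def)
    moreover have "n \<in> {1..n}" using n by simp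
    ultimately have "0 \<le> y \<bullet> (x + sum_list (take n w))" by blast
    then have "0 \<le> y \<bullet> (x + sum_list w)" using \<open>length w = n\<close> by simp
    then show ?thesis
      by (simp add: exp_add[symmetric] inner_add_right inner_commute)
  qed
  then have "real (card ?W) \<le> (\<Sum>w\<in>?W. exp (x \<bullet> y) * exp (sum_list w \<bullet> y))"
    using sum_mono[of ?W "\<lambda>_. 1::real"] by simp
  also have "\<dots> \<le> (\<Sum>w\<in>words S n. exp (x \<bullet> y) * exp (sum_list w \<bullet> y))"
    by (rule sum_mono2[OF finite_words[OF fin] walks_subset_words]) simp
  also have "\<dots> = exp (x \<bullet> y) * laplace S y ^ n"
    by (simp add: sum_distrib_left[symmetric] prod_list_exp_inner[symmetric]
        sum_words_prod_list laplace_def)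
  finally show ?thesis .
qed

lemma growth_constant_halfspace_le:
  fixes S :: "(real^'n) set"
  assumes fin: "finite S"
  shows "growth_constant S {z. 0 \<le> y \<bullet> z} x \<le> ereal (laplace S y)"
proof -
  have L: "0 \<le> laplace S y"
    unfolding laplace_def by (rule sum_nonneg) simp
  have "(\<lambda>n. ereal (root n (exp (x \<bullet> y)) * laplace S y)) \<longlonglongrightarrow> ereal (1 * laplace S y)"
    by (intro tendsto_intros tendsto_mult LIMSEQ_root_const) simp
  then have "limsup (\<lambda>n. ereal (root n (exp (x \<bullet> y)) * laplace S y)) = ereal (laplace S y)"
    by (simp add: lim_imp_Limsup)
  moreover have "growth_constant S {z. 0 \<le> y \<bullet> z} x
      \<le> limsup (\<lambda>n. ereal (root n (exp (x \<bullet> y)) * laplace S y))"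
    unfolding growth_constant_def
  proof (rule Limsup_mono, rule eventually_mono[OF eventually_gt_at_top[of 0]])
    fix n :: nat assume n: "0 < n"
    show "ereal (root n (real (card (walks S {z. 0 \<le> y \<bullet> z} x n))))
        \<le> ereal (root n (exp (x \<bullet> y)) * laplace S y)"
      using real_root_le_mono[OF n card_walks_halfspace_le[OF fin n, of y x]] n L
      by (simp add: real_root_mult real_root_power_cancel)
  qed
  ultimately show ?thesis by simp
qed

section \<open>Growth in the orthant from blocks that end in the orthant\<close>

text \<open>
  Unlike in \<open>walks\<close>, the empty prefix counts, so that confinement of a concatenation follows from
  that of its parts; indices beyond the length just repeat the endpoint.
\<close>

definition confined :: "(real^'n) set \<Rightarrow> real^'n \<Rightarrow> (real^'n) list \<Rightarrow> bool" where
  "confined A x w \<longleftrightarrow> (\<forall>k. x + sum_list (take k w) \<in> A)"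

lemma confined_append:
  assumes "confined A x v" "confined A (x + sum_list v) w"
  shows "confined A x (v @ w)"
  unfolding confined_def
proof
  fix k
  show "x + sum_list (take k (v @ w)) \<in> A"
  proof (cases "k \<le> length v")
    case True
    then show ?thesis using assms(1) by (simp add: confined_def)
  next
    case False
    then show ?thesis using assms(2) by (simp add: confined_def add.assoc[symmetric])
  qed
qed

lemma confined_imp_walk:
  "w \<in> words S n \<Longrightarrow> confined A x w \<Longrightarrow> w \<in> walks S A x n"
  by (auto simp: words_def walks_def confined_def)

lemma orthant_add: "x \<in> orthant \<Longrightarrow> y \<in> orthant \<Longrightarrow> x + y \<in> orthant"
  by (simp add: orthant_def)

lemma sum_list_concat_replicate:
  "sum_list (concat (replicate q v)) = real q *\<^sub>R sum_list v" for v :: "'a::real_vector list"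
  by (induction q) (simp_all add: scaleR_left_distrib)

lemma confined_replicate:
  fixes x :: "real^'n"
  assumes "confined orthant 0 v" "x \<in> orthant"
  shows "confined orthant x (concat (replicate q v))"
  using assms(2)
proof (induction q arbitrary: x)
  case 0
  then show ?case by (simp add: confined_def)
next
  case (Suc q)
  have v: "sum_list (take k v) \<in> orthant" for k
    using assms(1) by (simp add: confined_def)
  have "confined orthant x v"
    using v Suc.prems by (simp add: confined_def orthant_add)
  moreover have "x + sum_list v \<in> orthant"
    using v[of "length v"] Suc.prems by (simp add: orthant_add)
  ultimately show ?case
    using Suc.IH by (simp add: confined_append)
qed

lemma sum_list_component_ge:
  fixes w :: "(real^'n) list" and R :: real
  assumes "\<And>s. s \<in> set w \<Longrightarrow> norm s \<le> R"
  shows "- (length w * R) \<le> sum_list w $ i"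
  using assms
proof (induction w)
  case (Cons s w)
  have "- R \<le> s $ i"
    using Cons.prems[of s] component_le_norm_cart[of s i] by auto
  with Cons show ?case by (simp add: algebra_simps)
qed simp

text \<open>
  A block can lower a coordinate by at most \<open>N * R\<close> on its way, and at its end no coordinate is lower
  than at its start. Hence the margin \<open>N * R\<close> is available again for the next block.
\<close>

lemma confined_concat_blocks:
  fixes z :: "real^'n" and R :: real
  assumes S: "\<And>s. s \<in> S \<Longrightarrow> norm s \<le> R" and R: "0 \<le> R"
    and bs: "set bs \<subseteq> {w \<in> words S N. sum_list w \<in> orthant}"
    and z: "\<And>i. N * R \<le> z $ i"
  shows "confined orthant z (concat bs)"
  using bs z
proof (induction bs arbitrary: z)
  case Nil
  then have "0 \<le> z $ i" for i
    using R by (meson mult_nonneg_nonneg of_nat_0_le_iff order_trans)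
  then show ?case by (simp add: confined_def orthant_def)
next
  case (Cons b bs)
  then have b: "set b \<subseteq> S" "length b = N" "sum_list b \<in> orthant"
    by (auto simp: words_def)
  have "confined orthant z b"
    unfolding confined_def
  proof
    fix k
    have "0 \<le> (z + sum_list (take k b)) $ i" for i
    proof -
      have "- (length (take k b) * R) \<le> sum_list (take k b) $ i"
        by (rule sum_list_component_ge) (use S b(1) in \<open>blast dest: in_set_takeD\<close>)
      moreover have "length (take k b) * R \<le> N * R"
        using b(2) R by (intro mult_right_mono) auto
      ultimately show ?thesis
        using Cons.prems(2)[of i] by simp
    qed
    then show "z + sum_list (take k b) \<in> orthant" by (simp add: orthant_def)
  qed
  moreover have "confined orthant (z + sum_list b) (concat bs)"
  proof (rule Cons.IH)
    show "set bs \<subseteq> {w \<in> words S N. sum_list w \<in> orthant}" using Cons.prems by auto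
  next
    fix i
    have "0 \<le> sum_list b $ i" using b(3) by (simp add: orthant_def)
    then show "N * R \<le> (z + sum_list b) $ i" using Cons.prems(2)[of i] by simp
  qed
  ultimately show ?case by (simp add: confined_append)
qed

lemma inj_on_concat_blocks:
  assumes "\<And>b. b \<in> B \<Longrightarrow> length b = N"
  shows "inj_on concat (words B j)"
proof (rule inj_onI)
  fix xs ys assume *: "xs \<in> words B j" "ys \<in> words B j" "concat xs = concat ys"
  have len: "length b = N" if "b \<in> set xs \<union> set ys" for b
    using that * assms by (auto simp: words_def)
  show "xs = ys"
  proof (rule concat_injective)
    show "\<forall>(a, b)\<in>set (zip xs ys). length a = length b"
      using len by (auto dest: set_zip_leftD set_zip_rightD)
  qed (use * in \<open>auto simp: words_def\<close>)
qed

text \<open>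
  A fixed initial path that leads far enough from the boundary, followed by \<open>j\<close> blocks chosen
  independently, gives \<open>a ^ j\<close> walks of length \<open>j * N\<close> plus a constant. The \<open>limsup\<close> along these
  lengths is the \<open>N\<close>-th root of \<open>a\<close>. The number \<open>a\<close> is only a lower bound for the number of blocks,
  and real, so that explicit estimates can be inserted.
\<close>

lemma growth_constant_orthant_ge_block_root:
  fixes S :: "(real^'n) set"
  assumes fin: "finite S" and x: "x \<in> orthant"
    and v: "set v \<subseteq> S" "confined orthant 0 v" "\<And>i. 1 \<le> sum_list v $ i"
    and N: "0 < N"
    and a: "0 < a" "a \<le> real (card {w \<in> words S N. sum_list w \<in> orthant})"
  shows "ereal (root N a) \<le> growth_constant S orthant x"
proof -
  define B where "B = {w \<in> words S N. sum_list w \<in> orthant}"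
  obtain R where R: "\<And>s. s \<in> S \<Longrightarrow> norm s \<le> R" "0 < R"
    using finite_imp_bounded[OF fin] unfolding bounded_pos by blast
  obtain q :: nat where q: "N * R \<le> q"
    using real_arch_simple by blast
  define u where "u = concat (replicate q v)"
  have len_u: "length u = q * length v"
    by (simp add: u_def length_concat sum_list_replicate)
  have u_S: "set u \<subseteq> S" using v(1) by (auto simp: u_def)
  have far: "N * R \<le> (x + sum_list u) $ i" for i
  proof -
    have "0 \<le> x $ i" using x by (simp add: orthant_def)
    moreover have "real q * 1 \<le> real q * sum_list v $ i"
      using v(3)[of i] by (intro mult_left_mono) auto
    ultimately show ?thesis
      using q by (simp add: u_def sum_list_concat_replicate)
  qed
  have len_concat: "length (concat bs) = j * N" if "bs \<in> words B j" for bs j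
    using that by (induction bs arbitrary: j) (auto simp: words_def B_def)
  have count: "a ^ j \<le> card (walks S orthant x (length u + j * N))" for j
  proof -
    have "(\<lambda>bs. u @ concat bs) ` words B j \<subseteq> walks S orthant x (length u + j * N)"
    proof (intro image_subsetI confined_imp_walk)
      fix bs assume bs: "bs \<in> words B j"
      then have bsB: "set bs \<subseteq> B" by (simp add: words_def)
      have "set (concat bs) \<subseteq> S" using bsB by (auto simp: B_def words_def)
      then show "u @ concat bs \<in> words S (length u + j * N)"
        using u_S len_concat[OF bs] by (simp add: words_def)
      have "confined orthant (x + sum_list u) (concat bs)"
        using R bsB far by (intro confined_concat_blocks[of S R bs N]) (auto simp: B_def)
      then show "confined orthant x (u @ concat bs)"
        using confined_replicate[OF v(2) x] by (intro confined_append) (auto simp: u_def)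
    qed
    moreover have "inj_on (\<lambda>bs. u @ concat bs) (words B j)"
      using inj_on_concat_blocks[of B N j] by (auto simp: B_def words_def inj_on_def)
    ultimately have "card (words B j) \<le> card (walks S orthant x (length u + j * N))"
      using fin by (metis card_image card_mono finite_walks)
    moreover have "card (words B j) = card B ^ j"
      unfolding words_def by (rule card_lists_length_eq) (simp add: B_def finite_words fin)
    moreover have "a ^ j \<le> real (card B) ^ j"
      using a by (intro power_mono) (auto simp: B_def)
    ultimately show ?thesis
      by (metis of_nat_le_iff of_nat_power order_trans)
  qed
  define r where "r j = length u + j * N" for j
  have "strict_mono r" using N by (auto simp: strict_mono_def r_def)
  define f where "f = (\<lambda>n. ereal (root n (real (card (walks S orthant x n)))))"
  have "(\<lambda>j. ereal (a powr (real j / real (r j)))) \<longlonglongrightarrow> ereal (a powr (1 / real N))"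
  proof -
    have "(\<lambda>j. real j / (real (length u) + real j * real N)) \<longlonglongrightarrow> inverse (real N)"
      using N by real_asymp
    then show ?thesis
      using a(1) by (auto simp: r_def inverse_eq_divide intro!: tendsto_powr tendsto_const)
  qed
  then have "limsup (\<lambda>j. ereal (a powr (real j / real (r j)))) = ereal (root N a)"
    using a N by (simp add: lim_imp_Limsup root_powr_inverse inverse_eq_divide)
  moreover have "limsup (\<lambda>j. ereal (a powr (real j / real (r j)))) \<le> limsup (f \<circ> r)"
  proof (rule Limsup_mono, rule eventually_mono[OF eventually_gt_at_top[of 0]])
    fix j :: nat assume "0 < j"
    then have r: "0 < r j" using N by (simp add: r_def)
    have "a powr (real j / real (r j)) = root (r j) (a ^ j)"
      using a r by (simp add: root_powr_inverse powr_realpow[symmetric] powr_powr divide_inverse)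
    also have "\<dots> \<le> root (r j) (real (card (walks S orthant x (r j))))"
      using count[of j] r by (simp add: r_def)
    finally show "ereal (a powr (real j / real (r j))) \<le> (f \<circ> r) j"
      by (simp add: f_def)
  qed
  moreover have "limsup (f \<circ> r) \<le> limsup f"
    by (rule limsup_subseq_mono) fact
  ultimately show ?thesis
    by (simp add: growth_constant_def f_def)
qed

section \<open>Blocks from the tilted law\<close>

text \<open>
  Chebyshev's inequality for the tilted law, whose mean \<open>m\<close> is the gradient divided by \<open>laplace S y\<close>.
  The deviation \<open>c * M\<close> is at least \<open>sqrt 2\<close> times the standard deviation of \<open>M\<^sup>2\<close> steps, so a word
  stays within it with probability at least one half. There \<open>m \<bullet> y \<le> 0\<close> bounds the probability of a
  single word from above, which turns the probability into a number of words, and nonnegativity of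
  the coordinates of \<open>m\<close> bounds the coordinates of the sum from below.
\<close>

lemma card_words_near_orthant:
  fixes S :: "(real^'n) set"
  assumes fin: "finite S" and ne: "S \<noteq> {}"
    and grad: "(\<Sum>s\<in>S. exp (s \<bullet> y) *\<^sub>R s) \<in> orthant" "(\<Sum>s\<in>S. exp (s \<bullet> y) *\<^sub>R s) \<bullet> y \<le> 0"
  obtains c :: nat where "0 < c"
    "\<And>M. 0 < M \<Longrightarrow> laplace S y ^ (M\<^sup>2) * exp (- (norm y * c * M)) / 2
       \<le> card {w \<in> words S (M\<^sup>2). \<forall>i. - real (c * M) \<le> sum_list w $ i}"
proof -
  define L where "L = laplace S y"
  have L: "0 < L" using laplace_pos[OF fin ne] by (simp add: L_def)
  define p where "p s = exp (s \<bullet> y) / L" for s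
  define m where "m = (\<Sum>s\<in>S. p s *\<^sub>R s)"
  define V where "V = (\<Sum>s\<in>S. p s * (norm (s - m))\<^sup>2)"
  have m_eq: "m = (\<Sum>s\<in>S. exp (s \<bullet> y) *\<^sub>R s) /\<^sub>R L"
    by (simp add: m_def p_def scaleR_sum_right divide_inverse mult.commute)
  have m_orth: "0 \<le> m $ i" for i
    using grad(1) L by (simp add: m_eq orthant_def)
  have my: "m \<bullet> y \<le> 0"
    using grad(2) L by (simp add: m_eq mult_nonneg_nonpos)
  have p1: "(\<Sum>s\<in>S. p s) = 1"
    using L by (simp add: p_def sum_divide_distrib[symmetric] L_def laplace_def)
  have p0: "0 \<le> p s" for s using L by (simp add: p_def)
  have g0: "(\<Sum>s\<in>S. p s *\<^sub>R (s - m)) = 0"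
    by (simp add: scaleR_right_diff_distrib sum_subtractf scaleR_sum_left[symmetric] p1 m_def[symmetric])
  have V0: "0 \<le> V" unfolding V_def using p0 by (intro sum_nonneg) auto
  \<comment> \<open>The summand \<open>1\<close> keeps \<open>c\<close> positive when the law is degenerate; then \<open>2 * V \<le> c\<^sup>2\<close>, as
    \<open>c \<le> c\<^sup>2\<close>.\<close>
  obtain c :: nat where c: "2 * V + 1 \<le> c" using real_arch_simple by blast
  have c0: "0 < c" using c V0 by (cases c) auto
  show thesis
  proof (rule that[OF c0])
    fix M :: nat assume M: "0 < M"
    define T where "T = real (c * M)"
    have T: "0 < T" using c0 M by (simp add: T_def)
    define W where "W = {w\<in>words S (M\<^sup>2). norm (sum_list (map (\<lambda>s. s - m) w)) \<le> T}"
    have sum_shift: "sum_list (map (\<lambda>s. s - m) w) = sum_list w - real (length w) *\<^sub>R m" for w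
      by (induction w) (simp_all add: algebra_simps)
    have prod_p: "prod_list (map p w) = exp (sum_list w \<bullet> y) / L ^ length w" for w
      by (induction w) (simp_all add: p_def inner_add_left exp_add)
    have WD: "length w = M\<^sup>2" "norm (sum_list w - real (M\<^sup>2) *\<^sub>R m) \<le> T" if "w \<in> W" for w
      using that sum_shift[of w] by (auto simp: W_def words_def)
    have "M\<^sup>2 * V / T\<^sup>2 = V / (real c)\<^sup>2"
      using M by (simp add: T_def power_mult_distrib)
    also have "\<dots> \<le> 1 / 2"
    proof -
      have "1 \<le> real c" using c0 by simp
      then have "real c \<le> (real c)\<^sup>2" by (rule self_le_power) simp
      then have "2 * V \<le> (real c)\<^sup>2" using c by linarith
      then show ?thesis using c0 by (simp add: divide_simps)
    qed
    finally have "1 / 2 \<le> 1 - M\<^sup>2 * V / T\<^sup>2" by simp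
    also have "\<dots> \<le> (\<Sum>w\<in>W. prod_list (map p w))"
      unfolding W_def V_def by (rule words_Chebyshev[OF fin p0 p1 g0 T])
    also have "\<dots> \<le> (\<Sum>w\<in>W. exp (norm y * T) / L ^ (M\<^sup>2))"
    proof (rule sum_mono)
      fix w assume w: "w \<in> W"
      have "sum_list w \<bullet> y = real (M\<^sup>2) * (m \<bullet> y) + (sum_list w - real (M\<^sup>2) *\<^sub>R m) \<bullet> y"
        by (simp add: inner_diff_left)
      also have "\<dots> \<le> 0 + norm (sum_list w - real (M\<^sup>2) *\<^sub>R m) * norm y"
        using my by (intro add_mono norm_cauchy_schwarz) (simp add: mult_nonneg_nonpos)
      also have "\<dots> \<le> norm y * T"
        using mult_right_mono[OF WD(2)[OF w] norm_ge_zero[of y]] by (simp add: mult.commute)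
      finally show "prod_list (map p w) \<le> exp (norm y * T) / L ^ (M\<^sup>2)"
        using L WD(1)[OF w] by (simp add: prod_p divide_right_mono)
    qed
    finally have "1 / 2 \<le> card W * exp (norm y * T) / L ^ (M\<^sup>2)" by simp
    then have "L ^ (M\<^sup>2) * exp (- (norm y * T)) / 2 \<le> card W"
      using L by (simp add: exp_minus field_simps)
    also have "W \<subseteq> {w \<in> words S (M\<^sup>2). \<forall>i. - T \<le> sum_list w $ i}"
    proof -
      have "- T \<le> sum_list w $ i" if "w \<in> W" for w i
      proof -
        have "\<bar>(sum_list w - real (M\<^sup>2) *\<^sub>R m) $ i\<bar> \<le> T"
          using WD(2)[OF that] component_le_norm_cart order_trans by blast
        moreover have "0 \<le> real (M\<^sup>2) * m $ i" using m_orth by simp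
        ultimately show ?thesis by simp
      qed
      then show ?thesis by (auto simp: W_def)
    qed
    then have "card W \<le> card {w \<in> words S (M\<^sup>2). \<forall>i. - T \<le> sum_list w $ i}"
      by (intro card_mono) (auto simp: finite_words fin)
    finally show "laplace S y ^ (M\<^sup>2) * exp (- (norm y * c * M)) / 2
       \<le> card {w \<in> words S (M\<^sup>2). \<forall>i. - real (c * M) \<le> sum_list w $ i}"
      by (simp add: T_def L_def mult.assoc)
  qed
qed

text \<open>
  Appending \<open>v\<close> once raises every coordinate by at least one, so \<open>q\<close> copies repair a deficit of \<open>q\<close>.
\<close>

lemma card_blocks_ge:
  fixes S :: "(real^'n) set"
  assumes fin: "finite S" and v: "set v \<subseteq> S" "\<And>i. 1 \<le> sum_list v $ i"
  shows "card {w \<in> words S n. \<forall>i. - real q \<le> sum_list w $ i}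
       \<le> card {w \<in> words S (n + q * length v). sum_list w \<in> orthant}"
proof (rule card_inj_on_le[where f = "\<lambda>w. w @ concat (replicate q v)"])
  show "(\<lambda>w. w @ concat (replicate q v)) ` {w \<in> words S n. \<forall>i. - real q \<le> sum_list w $ i}
      \<subseteq> {w \<in> words S (n + q * length v). sum_list w \<in> orthant}"
  proof (intro image_subsetI CollectI conjI)
    fix w assume w: "w \<in> {w \<in> words S n. \<forall>i. - real q \<le> sum_list w $ i}"
    then show "w @ concat (replicate q v) \<in> words S (n + q * length v)"
      using v(1) by (auto simp: words_def length_concat sum_list_replicate)
    have "0 \<le> sum_list w $ i + real q * sum_list v $ i" for i
    proof -
      have "- real q \<le> sum_list w $ i" using w by simp
      moreover have "real q * 1 \<le> real q * sum_list v $ i"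
        using v(2) by (intro mult_left_mono) auto
      ultimately show ?thesis by simp
    qed
    then show "sum_list (w @ concat (replicate q v)) \<in> orthant"
      by (simp add: orthant_def sum_list_concat_replicate)
  qed
qed (auto simp: inj_on_def finite_words fin)

text \<open>
  The first-order conditions at the minimiser, in the coordinate directions and in the direction of
  the origin, are the hypotheses needed to count words near the orthant. The resulting bound on the
  growth constant tends to \<open>laplace S y\<close> as \<open>M\<close> grows, because both the correction to the length and
  the loss in the exponent are linear in \<open>M\<close> while the main terms are quadratic.
\<close>

lemma growth_constant_orthant_ge_laplace_min:
  fixes S :: "(real^'n) set"
  assumes fin: "finite S" and x: "x \<in> orthant"
    and v: "set v \<subseteq> S" "confined orthant 0 v" "\<And>i. 1 \<le> sum_list v $ i"
    and y: "y \<in> orthant" and min: "\<And>z. z \<in> orthant \<Longrightarrow> laplace S y \<le> laplace S z"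
  shows "ereal (laplace S y) \<le> growth_constant S orthant x"
proof -
  have "v \<noteq> []"
    using v(3) by (metis not_one_le_zero sum_list.Nil zero_index)
  then have ne: "S \<noteq> {}"
    using v(1) by (cases v) auto
  define L where "L = laplace S y"
  have L: "0 < L" using laplace_pos[OF fin ne] by (simp add: L_def)
  have "(\<Sum>s\<in>S. exp (s \<bullet> y) *\<^sub>R s) \<in> orthant"
  proof -
    have "0 \<le> (\<Sum>s\<in>S. exp (s \<bullet> y) *\<^sub>R s) \<bullet> axis i 1" for i
      using y by (intro laplace_min_gradient_nonneg[OF min]) (auto simp: orthant_def axis_def)
    then show ?thesis by (simp add: orthant_def inner_axis)
  qed
  moreover have "0 \<le> (\<Sum>s\<in>S. exp (s \<bullet> y) *\<^sub>R s) \<bullet> (- y)"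
  proof (rule laplace_min_gradient_nonneg[OF min])
    fix t :: real assume "0 < t" "t \<le> 1"
    then have "t * y $ i \<le> y $ i" for i
      using y by (auto simp: orthant_def intro: mult_left_le_one_le)
    then show "y + t *\<^sub>R - y \<in> orthant" by (simp add: orthant_def)
  qed
  ultimately obtain c :: nat where c: "0 < c" and
    near: "\<And>M. 0 < M \<Longrightarrow> L ^ (M\<^sup>2) * exp (- (norm y * c * M)) / 2
       \<le> card {w \<in> words S (M\<^sup>2). \<forall>i. - real (c * M) \<le> sum_list w $ i}"
    using card_words_near_orthant[OF fin ne, of y] unfolding L_def by auto
  define l where "l = real (length v)"
  \<comment> \<open>\<open>exp (e M)\<close> is the root, of order the corrected block length, of the lower bound
    for the number of blocks.\<close>
  define e where "e M = (M\<^sup>2 * ln L - norm y * c * M - ln 2) / (M\<^sup>2 + c * M * l)" for M :: real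
  have "(\<lambda>M. e (real M)) \<longlonglongrightarrow> ln L"
    unfolding e_def by real_asymp
  then have "(\<lambda>M. ereal (exp (e (real M)))) \<longlonglongrightarrow> ereal (exp (ln L))"
    by (intro tendsto_intros)
  then have lim: "(\<lambda>M. ereal (exp (e (real M)))) \<longlonglongrightarrow> ereal L"
    using L by simp
  have "ereal (exp (e (real M))) \<le> growth_constant S orthant x" if M: "0 < M" for M :: nat
  proof -
    define N where "N = M\<^sup>2 + c * M * length v"
    define a where "a = L ^ (M\<^sup>2) * exp (- (norm y * c * M)) / 2"
    have N: "0 < N" using M by (simp add: N_def)
    have a0: "0 < a" using L by (simp add: a_def)
    have "a \<le> card {w \<in> words S (M\<^sup>2). \<forall>i. - real (c * M) \<le> sum_list w $ i}"
      using near[OF M] by (simp add: a_def)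
    also have "\<dots> \<le> card {w \<in> words S N. sum_list w \<in> orthant}"
      using card_blocks_ge[OF fin v(1,3), of "M\<^sup>2" "c * M"] by (simp add: N_def)
    finally have "ereal (root N a) \<le> growth_constant S orthant x"
      by (rule growth_constant_orthant_ge_block_root[OF fin x v N a0])
    moreover have "root N a = exp (e (real M))"
    proof -
      have "ln a = M\<^sup>2 * ln L - norm y * c * M - ln 2"
        using L by (simp add: a_def ln_div ln_mult ln_realpow)
      then have "e (real M) = ln a / N"
        by (simp add: e_def N_def l_def)
      then show ?thesis
        using N a0 by (simp add: root_powr_inverse powr_def divide_inverse mult.commute)
    qed
    ultimately show ?thesis by simp
  qed
  then have "ereal L \<le> growth_constant S orthant x"
    by (intro LIMSEQ_le_const2[OF lim]) (auto intro!: exI[of _ 1])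
  then show ?thesis by (simp add: L_def)
qed

section \<open>The minimum over the supporting hyperplanes\<close>

theorem corollary9:
  fixes S :: "(real^'n) set" and x :: "real^'n"
  assumes "finite S"
    and "\<forall>s\<in>S. \<forall>i. s $ i \<in> \<int>"
    and "\<not> (\<exists>H. linear_hyperplane H \<and> S \<subseteq> H)"
    and "\<not> (\<exists>u\<in>orthant - {0}. S \<subseteq> {y. u \<bullet> y \<le> 0})"
    and "\<exists>k\<ge>1. \<exists>s. length s = k \<and> set s \<subseteq> S
           \<and> (\<forall>j\<in>{1..k}. sum_list (take j s) \<in> orthant)
           \<and> sum_list s \<in> interior orthant"
    and "x \<in> orthant"
  shows "(\<exists>p\<in>supporting_hyperplanes.
            growth_constant S orthant x = growth_constant S (orthant_side p) x)
       \<and> (\<forall>p\<in>supporting_hyperplanes.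
            growth_constant S orthant x \<le> growth_constant S (orthant_side p) x)"
proof -
  have side: "orthant_side {z. u \<bullet> z = 0} = {z. 0 \<le> u \<bullet> z}"
    "orthant \<subseteq> {z. 0 \<le> u \<bullet> z}" "{z. u \<bullet> z = 0} \<in> supporting_hyperplanes"
    if "u \<in> orthant" "u \<noteq> 0" for u :: "real^'n"
  proof -
    show "orthant_side {z. u \<bullet> z = 0} = {z. 0 \<le> u \<bullet> z}"
      using that by (rule orthant_side_eq)
    show "orthant \<subseteq> {z. 0 \<le> u \<bullet> z}"
      using that by (auto simp: orthant_def inner_vec_def intro!: sum_nonneg)
    show "{z. u \<bullet> z = 0} \<in> supporting_hyperplanes"
      using that inner_orthant_pos[OF that]
      by (fastforce simp: supporting_hyperplanes_def linear_hyperplane_def interior_orthant)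
  qed
  have le: "growth_constant S orthant x \<le> growth_constant S (orthant_side p) x"
    if p: "p \<in> supporting_hyperplanes" for p
  proof -
    obtain u where "u \<in> orthant" "norm u = 1" "p = {z. u \<bullet> z = 0}"
      using p unfolding supporting_hyperplanes_eq by blast
    moreover from this have "u \<noteq> 0" by auto
    ultimately show ?thesis
      using side[of u] by (intro growth_constant_mono[OF assms(1)]) auto
  qed
  obtain v where v: "set v \<subseteq> S" "\<forall>j\<in>{1..length v}. sum_list (take j v) \<in> orthant"
    "sum_list v \<in> interior orthant"
    using assms(5) by blast
  have conf: "confined orthant 0 v"
    unfolding confined_def
  proof
    fix k
    consider "k = 0" | "k \<in> {1..length v}" | "length v < k" by force
    then show "0 + sum_list (take k v) \<in> orthant"
    proof cases
      case 3
      then show ?thesis using v(3) interior_subset by auto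
    qed (use v(2) in \<open>auto simp: orthant_def\<close>)
  qed
  have v1: "1 \<le> sum_list v $ i" for i
  proof -
    have "sum_list w $ i \<in> \<int>" if "set w \<subseteq> S" for w
      using that assms(2) by (induction w) auto
    then have "sum_list v $ i \<in> \<int>" using v(1) by blast
    moreover have "0 < sum_list v $ i" using v(3) by (simp add: interior_orthant)
    ultimately show ?thesis by (auto elim!: Ints_cases)
  qed
  obtain y where y: "y \<in> orthant" and min: "\<And>z. z \<in> orthant \<Longrightarrow> laplace S y \<le> laplace S z"
    using laplace_attains_min_on_orthant[OF assms(1) v(1) v1] by blast
  \<comment> \<open>If the minimum is at the origin, the bound is the number of steps, which holds for walks without
    any constraint, so that every supporting hyperplane will do.\<close>
  define u :: "real^'n" where "u = (if y = 0 then (\<chi> i. 1) else y)"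
  have u: "u \<in> orthant" "u \<noteq> 0"
    using y by (auto simp: u_def orthant_def vec_eq_iff)
  have "growth_constant S (orthant_side {z. u \<bullet> z = 0}) x \<le> growth_constant S {z. 0 \<le> y \<bullet> z} x"
    unfolding side(1)[OF u] by (rule growth_constant_mono[OF assms(1)]) (auto simp: u_def)
  also have "\<dots> \<le> ereal (laplace S y)"
    by (rule growth_constant_halfspace_le[OF assms(1)])
  also have "\<dots> \<le> growth_constant S orthant x"
    by (rule growth_constant_orthant_ge_laplace_min[OF assms(1,6) v(1) conf v1 y min])
  finally show ?thesis
    using le side(3)[OF u] antisym by blast
qed

end
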